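(* Let $(A,\circ_A)$ be a $\mathcal{P}$-algebra and let $M\in M_2(\mathbb{K})$. Then there is a compatible dual type-$M$ pre-$\mathcal{P}$-algebra structure $(A,\succ_A,\prec_A)$ on $(A,\circ_A)$ if and only if there is an invertible dual type-$M$ $\mathcal{O}$-operator $T:V\to A$ of $(A,\circ_A)$ associated to $(\alpha,\beta,V)$ for some vector space $V$ and some linear maps $\alpha,\beta:A\to\mathrm{End}_{\mathbb{K}}(V)$. In this case, given such a $T$, the multiplications $\succ_A$ and $\prec_A$ are defined by $$x\succ_A y=T\big(\alpha(x)T^{-1}(y)\big),\qquad x\prec_A y=T\big(\beta(y)T^{-1}(x)\big),\qquad \forall x,y\in A.$$
   Context: Throughout, $\mathbb{K}$ is an algebraically closed field of characteristic zero and all vector spaces are finite-dimensional over $\mathbb{K}$. $\mathcal{P}$ is a binary quadratic operad with one binary operation; a $\mathcal{P}$-algebra is a vector space $A$ with a bilinear multiplication $\circ_A$ satisfying a fixed set of identities (depending only on $\mathcal{P}$), each stating that a fixed $\mathbb{K}$-linear combination of the twelve monomials $(x_{\sigma(1)}\circ_A x_{\sigma(2)})\circ_A x_{\sigma(3)}$ and $x_{\sigma(1)}\circ_A(x_{\sigma(2)}\circ_A x_{\sigma(3)})$, $\sigma\in S_3$, vanishes for all $x_1,x_2,x_3\in A$ (if the generating operation of $\mathcal{P}$ is symmetric or antisymmetric, the corresponding identity $x\circ_A y=\pm y\circ_A x$ is also imposed). Representation: for a $\mathcal{P}$-algebra $(A,\circ_A)$, a vector space $V$ and linear maps $l,r:A\to\mathrm{End}_{\mathbb{K}}(V)$,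 the triple $(l,r,V)$ is a representation of $(A,\circ_A)$ if $A\oplus V$ is a $\mathcal{P}$-algebra with multiplication $(x+u)\circ_d(y+v)=x\circ_A y+l(x)v+r(y)u$ for $x,y\in A$, $u,v\in V$. For a linear map $\rho:A\to\mathrm{End}_{\mathbb{K}}(V)$, the map $\rho^*:A\to\mathrm{End}_{\mathbb{K}}(V^* )$ is defined by $\langle\rho^*(x)u^*,v\rangle=-\langle u^*,\rho(x)v\rangle$. For $M=\begin{pmatrix} a_1 & b_1 \\ a_2 & b_2 \end{pmatrix}$ and linear maps $f,g$, write $(f,g)M:=(a_1f+a_2g,\;b_1f+b_2g)$. For multiplications $\succ_A,\prec_A$ on $A$, set $L_{\succ_A}(x)y=x\succ_A y$ and $R_{\prec_A}(x)y=y\prec_A x$. Dual type-$M$ pre-$\mathcal{P}$-algebra: a vector space $A$ with bilinear multiplications $\succ_A,\prec_A$ such that $(A,\circ_A)$ with $x\circ_A y:=x\succ_A y+x\prec_A y$ is a $\mathcal{P}$-algebra and $\big((L^*_{\succ_A},R^*_{\prec_A})M,A^*\big)=(a_1L^*_{\succ_A}+a_2R^*_{\prec_A},\,b_1L^*_{\succ_A}+b_2R^*_{\prec_A},\,A^* )$ is a representation of $(A,\circ_A)$. It is then called compatible on $(A,\circ_A)$. Dual type-$M$ $\mathcal{O}$-operator: let $\alpha,\beta:A\to\mathrm{End}_{\mathbb{K}}(V)$ be linear maps such that $\big((\alpha^*,\beta^* )M,V^*\big)$ is a representation of $(A,\circ_A)$. A linear map $T:V\to A$ with $(Tu)\circ_A(Tv)=T\big(\alpha(Tu)v+\beta(Tv)u\big)$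 for all $u,v\in V$ is called a dual type-$M$ $\mathcal{O}$-operator of $(A,\circ_A)$ associated to $(\alpha,\beta,V)$. *)

theory Defs
  imports
    "Jordan_Normal_Form.Matrix"
    "Jordan_Normal_Form.Missing_VectorSpace"
    "HOL-Algebra.Algebraic_Closure"
    "HOL-Combinatorics.Permutations"
begin

text \<open>
  Scalars form a field record \<open>K\<close>; vector spaces are records satisfying \<^locale>\<open>vectorspace\<close>,
  so all maps and multiplications are only meaningful on the carriers.
\<close>

definition char_zero :: "('k, 'm) ring_scheme \<Rightarrow> bool" where
  "char_zero K \<longleftrightarrow> (\<forall>n::nat. n > 0 \<longrightarrow> [n] \<cdot>\<^bsub>K\<^esub> \<one>\<^bsub>K\<^esub> \<noteq> \<zero>\<^bsub>K\<^esub>)"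

definition fd_vectorspace :: "'k ring \<Rightarrow> ('k, 'v) module \<Rightarrow> bool" where
  "fd_vectorspace K V \<longleftrightarrow> vectorspace K V \<and> vectorspace.fin_dim K V"


subsection \<open>Spaces of linear maps\<close>

text \<open>
  Linear maps are taken \<^const>\<open>extensional\<close> so that they are determined by their values on
  \<open>carrier V\<close>. As in \<^const>\<open>direct_sum\<close>, the fields \<open>mult\<close> and \<open>one\<close> of the module record
  carry no information.
\<close>

definition hom_space :: "'k ring \<Rightarrow> ('k, 'v) module \<Rightarrow> ('k, 'w) module \<Rightarrow> ('k, 'v \<Rightarrow> 'w) module" where
  "hom_space K V W =
     \<lparr>carrier = module_hom K V W \<inter> extensional (carrier V),
      mult = undefined, one = undefined,
      zero = (\<lambda>v\<in>carrier V. \<zero>\<^bsub>W\<^esub>),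
      add = (\<lambda>f g. \<lambda>v\<in>carrier V. f v \<oplus>\<^bsub>W\<^esub> g v),
      smult = (\<lambda>c f. \<lambda>v\<in>carrier V. c \<odot>\<^bsub>W\<^esub> f v)\<rparr>"

definition scalar_space :: "'k ring \<Rightarrow> ('k, 'k) module" where
  "scalar_space K =
     \<lparr>carrier = carrier K, mult = undefined, one = undefined,
      zero = \<zero>\<^bsub>K\<^esub>, add = add K, smult = mult K\<rparr>"

abbreviation End_space :: "'k ring \<Rightarrow> ('k, 'v) module \<Rightarrow> ('k, 'v \<Rightarrow> 'v) module" where
  "End_space K V \<equiv> hom_space K V V"

abbreviation dual_space :: "'k ring \<Rightarrow> ('k, 'v) module \<Rightarrow> ('k, 'v \<Rightarrow> 'k) module" where
  "dual_space K V \<equiv> hom_space K V (scalar_space K)"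

definition dual_map ::
  "'k ring \<Rightarrow> ('k, 'v) module \<Rightarrow> ('a \<Rightarrow> 'v \<Rightarrow> 'v) \<Rightarrow> 'a \<Rightarrow> ('v \<Rightarrow> 'k) \<Rightarrow> ('v \<Rightarrow> 'k)" where
  "dual_map K V \<rho> x = (\<lambda>u\<in>carrier (dual_space K V). \<lambda>v\<in>carrier V. \<ominus>\<^bsub>K\<^esub> u (\<rho> x v))"

text \<open>
  Column \<open>j\<close> of \<open>(f, g) M\<close> for maps \<open>f\<close>, \<open>g\<close> into \<open>End W\<close>. Matrix indices start at 0.
\<close>

definition pair_times_mat ::
  "'k ring \<Rightarrow> ('k, 'w) module \<Rightarrow> ('a \<Rightarrow> 'w \<Rightarrow> 'w) \<Rightarrow> ('a \<Rightarrow> 'w \<Rightarrow> 'w) \<Rightarrow> 'k mat \<Rightarrow> nat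
     \<Rightarrow> 'a \<Rightarrow> 'w \<Rightarrow> 'w" where
  "pair_times_mat K W f g M j x =
     (M $$ (0, j) \<odot>\<^bsub>End_space K W\<^esub> f x) \<oplus>\<^bsub>End_space K W\<^esub> (M $$ (1, j) \<odot>\<^bsub>End_space K W\<^esub> g x)"


subsection \<open>Binary quadratic operads and their algebras\<close>

datatype op_symmetry = No_Symmetry | Symmetric | Antisymmetric

datatype bracketing = Left_Bracketed | Right_Bracketed

text \<open>
  An operad is given by the symmetry of its generating operation and a set of relations.
  A relation assigns a coefficient to each of the twelve monomials, which are indexed by a
  permutation of \<open>{1, 2, 3}\<close> and a bracketing; values at other functions \<open>nat \<Rightarrow> nat\<close> are ignored.
\<close>

type_synonym 'k quadratic_relation = "(nat \<Rightarrow> nat) \<Rightarrow> bracketing \<Rightarrow> 'k"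

record 'k binary_quadratic_operad =
  op_sym :: op_symmetry
  relations :: "'k quadratic_relation set"

definition operad_over :: "'k ring \<Rightarrow> 'k binary_quadratic_operad \<Rightarrow> bool" where
  "operad_over K P \<longleftrightarrow>
     (\<forall>c\<in>relations P. \<forall>\<sigma> b. \<sigma> permutes {1, 2, 3} \<longrightarrow> c \<sigma> b \<in> carrier K)"

fun monomial :: "('a \<Rightarrow> 'a \<Rightarrow> 'a) \<Rightarrow> (nat \<Rightarrow> 'a) \<Rightarrow> (nat \<Rightarrow> nat) \<Rightarrow> bracketing \<Rightarrow> 'a" where
  "monomial m x \<sigma> Left_Bracketed = m (m (x (\<sigma> 1)) (x (\<sigma> 2))) (x (\<sigma> 3))"
| "monomial m x \<sigma> Right_Bracketed = m (x (\<sigma> 1)) (m (x (\<sigma> 2)) (x (\<sigma> 3)))"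

definition satisfies_relation ::
  "('k, 'a) module \<Rightarrow> ('a \<Rightarrow> 'a \<Rightarrow> 'a) \<Rightarrow> 'k quadratic_relation \<Rightarrow> bool" where
  "satisfies_relation A m c \<longleftrightarrow>
     (\<forall>x. x 1 \<in> carrier A \<and> x 2 \<in> carrier A \<and> x 3 \<in> carrier A \<longrightarrow>
       (\<Oplus>\<^bsub>A\<^esub>\<sigma>\<in>{\<sigma>. \<sigma> permutes {1, 2, 3}}.
          (c \<sigma> Left_Bracketed \<odot>\<^bsub>A\<^esub> monomial m x \<sigma> Left_Bracketed)
          \<oplus>\<^bsub>A\<^esub> (c \<sigma> Right_Bracketed \<odot>\<^bsub>A\<^esub> monomial m x \<sigma> Right_Bracketed)) = \<zero>\<^bsub>A\<^esub>)"

fun satisfies_symmetry :: "op_symmetry \<Rightarrow> ('k, 'a) module \<Rightarrow> ('a \<Rightarrow> 'a \<Rightarrow> 'a) \<Rightarrow> bool" where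
  "satisfies_symmetry No_Symmetry A m \<longleftrightarrow> True"
| "satisfies_symmetry Symmetric A m \<longleftrightarrow> (\<forall>x\<in>carrier A. \<forall>y\<in>carrier A. m x y = m y x)"
| "satisfies_symmetry Antisymmetric A m \<longleftrightarrow> (\<forall>x\<in>carrier A. \<forall>y\<in>carrier A. m x y = \<ominus>\<^bsub>A\<^esub> m y x)"

definition bilinear_mult :: "'k ring \<Rightarrow> ('k, 'a) module \<Rightarrow> ('a \<Rightarrow> 'a \<Rightarrow> 'a) \<Rightarrow> bool" where
  "bilinear_mult K A m \<longleftrightarrow>
     (\<forall>x\<in>carrier A. (\<lambda>y. m x y) \<in> module_hom K A A) \<and>
     (\<forall>y\<in>carrier A. (\<lambda>x. m x y) \<in> module_hom K A A)"

definition P_algebra ::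
  "'k ring \<Rightarrow> 'k binary_quadratic_operad \<Rightarrow> ('k, 'a) module \<Rightarrow> ('a \<Rightarrow> 'a \<Rightarrow> 'a) \<Rightarrow> bool" where
  "P_algebra K P A m \<longleftrightarrow>
     vectorspace K A \<and> bilinear_mult K A m \<and>
     satisfies_symmetry (op_sym P) A m \<and>
     (\<forall>c\<in>relations P. satisfies_relation A m c)"

definition representation ::
  "'k ring \<Rightarrow> 'k binary_quadratic_operad \<Rightarrow> ('k, 'a) module \<Rightarrow> ('a \<Rightarrow> 'a \<Rightarrow> 'a)
     \<Rightarrow> ('a \<Rightarrow> 'v \<Rightarrow> 'v) \<Rightarrow> ('a \<Rightarrow> 'v \<Rightarrow> 'v) \<Rightarrow> ('k, 'v) module \<Rightarrow> bool" where
  "representation K P A m l r V \<longleftrightarrow>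
     P_algebra K P A m \<and> vectorspace K V \<and>
     l \<in> module_hom K A (End_space K V) \<and> r \<in> module_hom K A (End_space K V) \<and>
     P_algebra K P (direct_sum A V) (\<lambda>(x, u) (y, v). (m x y, l x v \<oplus>\<^bsub>V\<^esub> r y u))"


subsection \<open>Dual type-\<open>M\<close> pre-\<open>P\<close>-algebras and \<open>O\<close>-operators\<close>

definition left_mult :: "('k, 'a) module \<Rightarrow> ('a \<Rightarrow> 'a \<Rightarrow> 'a) \<Rightarrow> 'a \<Rightarrow> 'a \<Rightarrow> 'a" where
  "left_mult A m x = (\<lambda>y\<in>carrier A. m x y)"

definition right_mult :: "('k, 'a) module \<Rightarrow> ('a \<Rightarrow> 'a \<Rightarrow> 'a) \<Rightarrow> 'a \<Rightarrow> 'a \<Rightarrow> 'a" where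
  "right_mult A m x = (\<lambda>y\<in>carrier A. m y x)"

definition dual_representation ::
  "'k ring \<Rightarrow> 'k binary_quadratic_operad \<Rightarrow> 'k mat \<Rightarrow> ('k, 'a) module \<Rightarrow> ('a \<Rightarrow> 'a \<Rightarrow> 'a)
     \<Rightarrow> ('a \<Rightarrow> 'v \<Rightarrow> 'v) \<Rightarrow> ('a \<Rightarrow> 'v \<Rightarrow> 'v) \<Rightarrow> ('k, 'v) module \<Rightarrow> bool" where
  "dual_representation K P M A m \<alpha> \<beta> V \<longleftrightarrow>
     representation K P A m
       (pair_times_mat K (dual_space K V) (dual_map K V \<alpha>) (dual_map K V \<beta>) M 0)
       (pair_times_mat K (dual_space K V) (dual_map K V \<alpha>) (dual_map K V \<beta>) M 1)
       (dual_space K V)"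

definition dual_pre_P_algebra ::
  "'k ring \<Rightarrow> 'k binary_quadratic_operad \<Rightarrow> 'k mat \<Rightarrow> ('k, 'a) module
     \<Rightarrow> ('a \<Rightarrow> 'a \<Rightarrow> 'a) \<Rightarrow> ('a \<Rightarrow> 'a \<Rightarrow> 'a) \<Rightarrow> bool" where
  "dual_pre_P_algebra K P M A succ prec \<longleftrightarrow>
     vectorspace K A \<and> bilinear_mult K A succ \<and> bilinear_mult K A prec \<and>
     P_algebra K P A (\<lambda>x y. succ x y \<oplus>\<^bsub>A\<^esub> prec x y) \<and>
     dual_representation K P M A (\<lambda>x y. succ x y \<oplus>\<^bsub>A\<^esub> prec x y)
       (left_mult A succ) (right_mult A prec) A"

definition compatible_dual_pre_P_algebra ::
  "'k ring \<Rightarrow> 'k binary_quadratic_operad \<Rightarrow> 'k mat \<Rightarrow> ('k, 'a) module \<Rightarrow> ('a \<Rightarrow> 'a \<Rightarrow> 'a)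
     \<Rightarrow> ('a \<Rightarrow> 'a \<Rightarrow> 'a) \<Rightarrow> ('a \<Rightarrow> 'a \<Rightarrow> 'a) \<Rightarrow> bool" where
  "compatible_dual_pre_P_algebra K P M A m succ prec \<longleftrightarrow>
     dual_pre_P_algebra K P M A succ prec \<and>
     (\<forall>x\<in>carrier A. \<forall>y\<in>carrier A. m x y = succ x y \<oplus>\<^bsub>A\<^esub> prec x y)"

definition dual_O_operator ::
  "'k ring \<Rightarrow> 'k binary_quadratic_operad \<Rightarrow> 'k mat \<Rightarrow> ('k, 'a) module \<Rightarrow> ('a \<Rightarrow> 'a \<Rightarrow> 'a)
     \<Rightarrow> ('a \<Rightarrow> 'v \<Rightarrow> 'v) \<Rightarrow> ('a \<Rightarrow> 'v \<Rightarrow> 'v) \<Rightarrow> ('k, 'v) module \<Rightarrow> ('v \<Rightarrow> 'a) \<Rightarrow> bool" where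
  "dual_O_operator K P M A m \<alpha> \<beta> V T \<longleftrightarrow>
     \<alpha> \<in> module_hom K A (End_space K V) \<and> \<beta> \<in> module_hom K A (End_space K V) \<and>
     dual_representation K P M A m \<alpha> \<beta> V \<and>
     linear_map K V A T \<and>
     (\<forall>u\<in>carrier V. \<forall>v\<in>carrier V. m (T u) (T v) = T (\<alpha> (T u) v \<oplus>\<^bsub>V\<^esub> \<beta> (T v) u))"

text \<open>
  Since \<open>T\<close> identifies \<open>V\<close> with \<open>A\<close>, a space \<open>V\<close> admitting such an operator can always be realised
  with elements in the element type of \<open>A\<close>.
\<close>

definition invertible_dual_O_operator ::
  "'k ring \<Rightarrow> 'k binary_quadratic_operad \<Rightarrow> 'k mat \<Rightarrow> ('k, 'a) module \<Rightarrow> ('a \<Rightarrow> 'a \<Rightarrow> 'a)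
     \<Rightarrow> ('a \<Rightarrow> 'v \<Rightarrow> 'v) \<Rightarrow> ('a \<Rightarrow> 'v \<Rightarrow> 'v) \<Rightarrow> ('k, 'v) module \<Rightarrow> ('v \<Rightarrow> 'a) \<Rightarrow> bool" where
  "invertible_dual_O_operator K P M A m \<alpha> \<beta> V T \<longleftrightarrow>
     dual_O_operator K P M A m \<alpha> \<beta> V T \<and> bij_betw T (carrier V) (carrier A)"

end

theory Submission
  imports Defs
begin

text \<open>
  A bijective \<open>T : V \<rightarrow> A\<close> turns the operators \<open>\<alpha> x\<close>, \<open>\<beta> x\<close> on \<open>V\<close> into the operators
  \<open>T \<circ> \<alpha> x \<circ> T\<inverse>\<close>, \<open>T \<circ> \<beta> x \<circ> T\<inverse>\<close> on \<open>A\<close>, which are left and right multiplication for the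
  proposed products. Precomposition with \<open>T\<close> is an injective map \<open>A\<^sup>* \<rightarrow> V\<^sup>*\<close> intertwining the dual
  operators, and multilinear identities can be pulled back along injective linear maps, so the
  representation on \<open>V\<^sup>*\<close> yields the one on \<open>A\<^sup>*\<close>. Conversely, take \<open>V = A\<close> and \<open>T = id\<close>.
\<close>

section \<open>Linear maps\<close>

lemma module_homI:
  assumes "\<And>x. x \<in> carrier V \<Longrightarrow> f x \<in> carrier W"
    and "\<And>x y. x \<in> carrier V \<Longrightarrow> y \<in> carrier V \<Longrightarrow> f (x \<oplus>\<^bsub>V\<^esub> y) = f x \<oplus>\<^bsub>W\<^esub> f y"
    and "\<And>c x. c \<in> carrier K \<Longrightarrow> x \<in> carrier V \<Longrightarrow> f (c \<odot>\<^bsub>V\<^esub> x) = c \<odot>\<^bsub>W\<^esub> f x"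
  shows "f \<in> module_hom K V W"
  using assms by (auto simp: module_hom_def)

lemma module_hom_apply_closed: "f \<in> module_hom K V W \<Longrightarrow> x \<in> carrier V \<Longrightarrow> f x \<in> carrier W"
  by (auto simp: module_hom_def)

text \<open>\<open>module_hom\<close> inspects values on the carrier only, and the carrier of a
  vector space is closed under the operations. This is what permits restricting maps to make them
  extensional.\<close>

lemma module_hom_cong:
  assumes "vectorspace K V" and "f \<in> module_hom K V W"
    and "\<And>x. x \<in> carrier V \<Longrightarrow> g x = f x"
  shows "g \<in> module_hom K V W"
proof -
  interpret V: vectorspace K V by fact
  show ?thesis using assms(2,3) by (auto simp: module_hom_def)
qed

lemma module_hom_comp:
  assumes "f \<in> module_hom K V W" and "g \<in> module_hom K W U"
  shows "(\<lambda>x. g (f x)) \<in> module_hom K V U"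
  using assms by (auto simp: module_hom_def Pi_def)

lemma module_hom_finsum:
  assumes V: "vectorspace K V" and W: "vectorspace K W" and f: "f \<in> module_hom K V W"
    and "finite I" and "\<And>i. i \<in> I \<Longrightarrow> g i \<in> carrier V"
  shows "f (\<Oplus>\<^bsub>V\<^esub>i\<in>I. g i) = (\<Oplus>\<^bsub>W\<^esub>i\<in>I. f (g i))"
proof -
  interpret V: vectorspace K V by fact
  interpret W: vectorspace K W by fact
  interpret f: mod_hom K V W f by unfold_locales fact
  show ?thesis
    using assms(4,5)
  proof (induction I rule: finite_induct)
    case (insert i I)
    then show ?case by (simp add: Pi_def)
  qed simp
qed

text \<open>A sum or scalar multiple in \<open>W\<close> is the \<open>T\<close>-image of the same
  expression formed from preimages; applying the inverse then cancels \<open>T\<close>.\<close>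

lemma module_hom_inv_into:
  assumes "vectorspace K V" and T: "T \<in> module_hom K V W" and "bij_betw T (carrier V) (carrier W)"
  shows "inv_into (carrier V) T \<in> module_hom K W V"
proof -
  interpret V: vectorspace K V by fact
  let ?S = "inv_into (carrier V) T"
  have S: "?S w \<in> carrier V" "T (?S w) = w" if "w \<in> carrier W" for w
    using assms(3) that by (auto simp: bij_betw_def inv_into_into f_inv_into_f)
  have ST: "?S (T v) = v" if "v \<in> carrier V" for v
    using assms(3) that by (auto simp: bij_betw_def)
  show ?thesis
  proof (rule module_homI)
    fix x y assume "x \<in> carrier W" "y \<in> carrier W"
    then have "x \<oplus>\<^bsub>W\<^esub> y = T (?S x \<oplus>\<^bsub>V\<^esub> ?S y)"
      using module_hom_add[OF T] S by metis
    then show "?S (x \<oplus>\<^bsub>W\<^esub> y) = ?S x \<oplus>\<^bsub>V\<^esub> ?S y"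
      using ST S \<open>x \<in> carrier W\<close> \<open>y \<in> carrier W\<close> by simp
  next
    fix c x assume "c \<in> carrier K" "x \<in> carrier W"
    then have "c \<odot>\<^bsub>W\<^esub> x = T (c \<odot>\<^bsub>V\<^esub> ?S x)"
      using module_hom_smult[OF T] S by metis
    then show "?S (c \<odot>\<^bsub>W\<^esub> x) = c \<odot>\<^bsub>V\<^esub> ?S x"
      using ST S \<open>c \<in> carrier K\<close> \<open>x \<in> carrier W\<close> by simp
  qed (use S in simp)
qed

section \<open>Hom spaces and dual spaces as vector spaces\<close>

lemma hom_space_carrierI:
  assumes "vectorspace K V" and "f \<in> module_hom K V W"
  shows "(\<lambda>v\<in>carrier V. f v) \<in> carrier (hom_space K V W)"
  using module_hom_cong[OF assms, of "restrict f (carrier V)"] by (simp add: hom_space_def)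

lemma hom_space_carrierD: "f \<in> carrier (hom_space K V W) \<Longrightarrow> f \<in> module_hom K V W"
  by (simp add: hom_space_def)

lemma hom_space_ext:
  assumes "f \<in> carrier (hom_space K V W)" and "g \<in> carrier (hom_space K V W)"
    and "\<And>v. v \<in> carrier V \<Longrightarrow> f v = g v"
  shows "f = g"
  using assms by (auto simp: hom_space_def intro: extensionalityI)

lemma hom_space_add_apply [simp]:
  "v \<in> carrier V \<Longrightarrow> (f \<oplus>\<^bsub>hom_space K V W\<^esub> g) v = f v \<oplus>\<^bsub>W\<^esub> g v"
  by (simp add: hom_space_def)

lemma hom_space_smult_apply [simp]:
  "v \<in> carrier V \<Longrightarrow> (c \<odot>\<^bsub>hom_space K V W\<^esub> f) v = c \<odot>\<^bsub>W\<^esub> f v"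
  by (simp add: hom_space_def)

lemma hom_space_zero_apply [simp]:
  "v \<in> carrier V \<Longrightarrow> \<zero>\<^bsub>hom_space K V W\<^esub> v = \<zero>\<^bsub>W\<^esub>"
  by (simp add: hom_space_def)

lemma vectorspace_hom_space:
  assumes "vectorspace K V" and "vectorspace K W"
  shows "vectorspace K (hom_space K V W)"
proof -
  interpret V: vectorspace K V by fact
  interpret W: vectorspace K W by fact
  let ?H = "hom_space K V W"
  note hom = hom_space_carrierD[THEN module_hom_apply_closed]
    hom_space_carrierD[THEN module_hom_add] hom_space_carrierD[THEN module_hom_smult]
  have add: "f \<oplus>\<^bsub>?H\<^esub> g \<in> carrier ?H" if "f \<in> carrier ?H" "g \<in> carrier ?H" for f g
  proof -
    have "(\<lambda>v. f v \<oplus>\<^bsub>W\<^esub> g v) \<in> module_hom K V W"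
      by (rule module_homI) (use that in \<open>simp_all add: hom W.a_ac W.smult_r_distr\<close>)
    from hom_space_carrierI[OF assms(1) this] show ?thesis
      by (simp add: hom_space_def)
  qed
  have smult: "c \<odot>\<^bsub>?H\<^esub> f \<in> carrier ?H" if "c \<in> carrier K" "f \<in> carrier ?H" for c f
  proof -
    \<comment> \<open>Commutativity of \<open>K\<close> is what lets \<open>c\<close> pass the
      scalars pulled out of \<open>f\<close>.\<close>
    have "(\<lambda>v. c \<odot>\<^bsub>W\<^esub> f v) \<in> module_hom K V W"
      by (rule module_homI)
        (use that in \<open>simp_all add: hom W.smult_r_distr W.smult_assoc1[symmetric] V.m_comm\<close>)
    from hom_space_carrierI[OF assms(1) this] show ?thesis
      by (simp add: hom_space_def)
  qed
  have zero: "\<zero>\<^bsub>?H\<^esub> \<in> carrier ?H"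
  proof -
    have "(\<lambda>v. \<zero>\<^bsub>W\<^esub>) \<in> module_hom K V W"
      by (rule module_homI) simp_all
    from hom_space_carrierI[OF assms(1) this] show ?thesis
      by (simp add: hom_space_def)
  qed
  have "abelian_group ?H"
  proof (rule abelian_groupI)
    fix f assume f: "f \<in> carrier ?H"
    \<comment> \<open>The multiple of \<open>f\<close> by minus one is the witness for the additive
      inverse; its membership is already known from \<open>smult\<close>.\<close>
    have "(\<ominus>\<^bsub>K\<^esub> \<one>\<^bsub>K\<^esub>) \<odot>\<^bsub>?H\<^esub> f \<oplus>\<^bsub>?H\<^esub> f = \<zero>\<^bsub>?H\<^esub>"
      by (rule hom_space_ext[of _ K V W])
        (use f in \<open>simp_all add: add smult zero hom W.smult_l_minus W.l_neg\<close>)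
    then show "\<exists>g\<in>carrier ?H. g \<oplus>\<^bsub>?H\<^esub> f = \<zero>\<^bsub>?H\<^esub>"
      using smult f V.R.one_closed V.R.a_inv_closed by metis
  qed (auto simp: add zero hom W.a_ac intro!: hom_space_ext[of _ K V W])
  then have "module K ?H"
    by (intro moduleI V.R.is_cring)
      (auto simp: add smult hom W.smult_l_distr W.smult_r_distr W.smult_assoc1
        intro!: hom_space_ext[of _ K V W])
  then show ?thesis
    by (simp add: vectorspace_def V.field_axioms)
qed

lemma vectorspace_scalar_space:
  assumes "field K"
  shows "vectorspace K (scalar_space K)"
proof -
  interpret field K by fact
  have "abelian_group (scalar_space K)"
    by (rule abelian_groupI) (auto simp: scalar_space_def a_ac intro: l_neg)
  then have "module K (scalar_space K)"
    by (intro moduleI is_cring) (auto simp: scalar_space_def l_distr r_distr m_assoc)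
  then show ?thesis
    by (simp add: vectorspace_def assms)
qed

lemma vectorspace_dual_space:
  assumes "vectorspace K V"
  shows "vectorspace K (dual_space K V)"
  using assms by (auto intro: vectorspace_hom_space vectorspace_scalar_space vectorspace.axioms)

section \<open>Pulling back operadic identities\<close>

lemma monomial_closed:
  assumes "\<And>x y. x \<in> C \<Longrightarrow> y \<in> C \<Longrightarrow> m x y \<in> C"
    and "x (\<sigma> 1) \<in> C" and "x (\<sigma> 2) \<in> C" and "x (\<sigma> 3) \<in> C"
  shows "monomial m x \<sigma> b \<in> C"
  using assms by (cases b) auto

lemma monomial_hom:
  assumes "\<And>x y. x \<in> C \<Longrightarrow> y \<in> C \<Longrightarrow> m x y \<in> C"
    and "\<And>x y. x \<in> C \<Longrightarrow> y \<in> C \<Longrightarrow> f (m x y) = n (f x) (f y)"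
    and "x (\<sigma> 1) \<in> C" and "x (\<sigma> 2) \<in> C" and "x (\<sigma> 3) \<in> C"
  shows "f (monomial m x \<sigma> b) = monomial n (\<lambda>i. f (x i)) \<sigma> b"
  using assms by (cases b) auto

text \<open>The map \<open>f\<close> sends every monomial in \<open>m\<close> to the corresponding
  monomial in \<open>n\<close>, so it sends each side of an identity for \<open>m\<close> to the
  matching side of one that holds in \<open>B\<close>; injectivity then gives the identity in
  \<open>A\<close>. Bilinearity of \<open>m\<close> is inherited in the same way.\<close>

lemma P_algebra_pullback:
  assumes P: "operad_over K P" and B: "P_algebra K P B n" and A: "vectorspace K A"
    and f: "f \<in> module_hom K A B" and inj: "inj_on f (carrier A)"
    and closed: "\<And>x y. x \<in> carrier A \<Longrightarrow> y \<in> carrier A \<Longrightarrow> m x y \<in> carrier A"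
    and mult: "\<And>x y. x \<in> carrier A \<Longrightarrow> y \<in> carrier A \<Longrightarrow> f (m x y) = n (f x) (f y)"
  shows "P_algebra K P A m"
proof -
  have Bv: "vectorspace K B" using B by (simp add: P_algebra_def)
  interpret A: vectorspace K A by fact
  interpret B: vectorspace K B by fact
  interpret f: mod_hom K A B f by unfold_locales fact
  note f_eqD = inj_onD[OF inj]
  have nl: "(\<lambda>y. n x y) \<in> module_hom K B B" and nr: "(\<lambda>y. n y x) \<in> module_hom K B B"
    if "x \<in> carrier B" for x
    using B that by (auto simp: P_algebra_def bilinear_mult_def)
  have "bilinear_mult K A m"
    unfolding bilinear_mult_def
  proof (intro conjI ballI)
    fix x assume x: "x \<in> carrier A"
    show "(\<lambda>y. m x y) \<in> module_hom K A A"
      \<comment> \<open>Injectivity applies only to the additivity and homogeneity goals; the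
        closure goal passes through unchanged.\<close>
      by (intro module_homI; (rule f_eqD)?)
        (use x in \<open>simp_all add: closed mult module_hom_add[OF nl] module_hom_smult[OF nl]\<close>)
    show "(\<lambda>y. m y x) \<in> module_hom K A A"
      by (intro module_homI; (rule f_eqD)?)
        (use x in \<open>simp_all add: closed mult module_hom_add[OF nr] module_hom_smult[OF nr]\<close>)
  qed
  moreover have "satisfies_symmetry (op_sym P) A m"
  proof (cases "op_sym P")
    case Symmetric
    then have "satisfies_symmetry Symmetric B n"
      using B unfolding P_algebra_def by metis
    then have n: "n x y = n y x" if "x \<in> carrier B" "y \<in> carrier B" for x y
      unfolding satisfies_symmetry.simps using that by blast
    have "m x y = m y x" if "x \<in> carrier A" "y \<in> carrier A" for x y
      by (rule f_eqD) (use that n[of "f x" "f y"] in \<open>simp_all add: closed mult\<close>)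
    then show ?thesis
      unfolding Symmetric satisfies_symmetry.simps by blast
  next
    case Antisymmetric
    then have "satisfies_symmetry Antisymmetric B n"
      using B unfolding P_algebra_def by metis
    then have n: "n x y = \<ominus>\<^bsub>B\<^esub> n y x" if "x \<in> carrier B" "y \<in> carrier B" for x y
      unfolding satisfies_symmetry.simps using that by blast
    have "m x y = \<ominus>\<^bsub>A\<^esub> m y x" if "x \<in> carrier A" "y \<in> carrier A" for x y
      by (rule f_eqD) (use that n[of "f x" "f y"] in \<open>simp_all add: closed mult\<close>)
    then show ?thesis
      unfolding Antisymmetric satisfies_symmetry.simps by blast
  qed simp
  moreover have "satisfies_relation A m c" if c: "c \<in> relations P" for c
    unfolding satisfies_relation_def
  proof (intro allI impI)
    fix x :: "nat \<Rightarrow> _"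
    assume x: "x 1 \<in> carrier A \<and> x 2 \<in> carrier A \<and> x 3 \<in> carrier A"
    let ?S = "{\<sigma>. \<sigma> permutes {1, 2, 3::nat}}"
    let ?s = "\<lambda>\<sigma>. (c \<sigma> Left_Bracketed \<odot>\<^bsub>A\<^esub> monomial m x \<sigma> Left_Bracketed)
          \<oplus>\<^bsub>A\<^esub> (c \<sigma> Right_Bracketed \<odot>\<^bsub>A\<^esub> monomial m x \<sigma> Right_Bracketed)"
    let ?t = "\<lambda>\<sigma>. (c \<sigma> Left_Bracketed \<odot>\<^bsub>B\<^esub> monomial n (\<lambda>i. f (x i)) \<sigma> Left_Bracketed)
          \<oplus>\<^bsub>B\<^esub> (c \<sigma> Right_Bracketed \<odot>\<^bsub>B\<^esub> monomial n (\<lambda>i. f (x i)) \<sigma> Right_Bracketed)"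
    have cK: "c \<sigma> b \<in> carrier K" if "\<sigma> \<in> ?S" for \<sigma> b
      using P c that by (simp add: operad_over_def)
    \<comment> \<open>Nothing is known about \<open>x\<close> away from 1, 2, 3, but a permutation
      of these indices never leaves them.\<close>
    have xS: "x (\<sigma> i) \<in> carrier A" if "\<sigma> \<in> ?S" "i \<in> {1, 2, 3}" for \<sigma> i
      using that x permutes_in_image[of \<sigma> "{1, 2, 3}" i] by auto
    have mA: "monomial m x \<sigma> b \<in> carrier A" if "\<sigma> \<in> ?S" for \<sigma> b
      by (rule monomial_closed[OF closed]) (use xS[OF that] in auto)
    have fm: "f (monomial m x \<sigma> b) = monomial n (\<lambda>i. f (x i)) \<sigma> b" if "\<sigma> \<in> ?S" for \<sigma> b
      by (rule monomial_hom[where C = "carrier A" and f = f and m = m]) (use xS[OF that] in \<open>auto simp: closed mult\<close>)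
    \<comment> \<open>Monomials are kept folded here so that \<open>mA\<close> and \<open>fm\<close>
      apply to them as wholes.\<close>
    have st: "f (?s \<sigma>) = ?t \<sigma>" if "\<sigma> \<in> ?S" for \<sigma>
      using cK[OF that] mA[OF that] fm[OF that] by (simp del: monomial.simps)
    have fin: "finite ?S"
      by (rule finite_permutations) simp
    have sA: "?s \<sigma> \<in> carrier A" if "\<sigma> \<in> ?S" for \<sigma>
      using cK[OF that] mA[OF that] by (simp del: monomial.simps)
    have tB: "?t \<sigma> \<in> carrier B" if "\<sigma> \<in> ?S" for \<sigma>
      using f.f_im[OF sA[OF that]] st[OF that] by metis
    have "f (\<Oplus>\<^bsub>A\<^esub>\<sigma>\<in>?S. ?s \<sigma>) = (\<Oplus>\<^bsub>B\<^esub>\<sigma>\<in>?S. f (?s \<sigma>))"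
      by (rule module_hom_finsum[OF A Bv f fin sA])
    also have "\<dots> = (\<Oplus>\<^bsub>B\<^esub>\<sigma>\<in>?S. ?t \<sigma>)"
      by (rule B.finsum_cong') (use st tB in blast)+
    also have "\<dots> = \<zero>\<^bsub>B\<^esub>"
    proof -
      have "satisfies_relation B n c"
        using B c by (simp add: P_algebra_def)
      from this[unfolded satisfies_relation_def, rule_format, of "\<lambda>i. f (x i)"] x
      show ?thesis by simp
    qed
    finally have "f (\<Oplus>\<^bsub>A\<^esub>\<sigma>\<in>?S. ?s \<sigma>) = f \<zero>\<^bsub>A\<^esub>"
      by (simp only: f.f0_is_0)
    then show "(\<Oplus>\<^bsub>A\<^esub>\<sigma>\<in>?S. ?s \<sigma>) = \<zero>\<^bsub>A\<^esub>"
      using sA by (intro f_eqD A.finsum_closed) auto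
  qed
  ultimately show ?thesis
    using A by (simp add: P_algebra_def)
qed

text \<open>Pullback along the identity map. Products carry meaning on the carrier only, so two of
  them may represent the same algebra without being equal functions.\<close>

lemma P_algebra_cong:
  assumes "operad_over K P" and A: "P_algebra K P A m"
    and eq: "\<And>x y. x \<in> carrier A \<Longrightarrow> y \<in> carrier A \<Longrightarrow> m' x y = m x y"
  shows "P_algebra K P A m'"
proof (rule P_algebra_pullback[OF assms(1) A, of A "\<lambda>x. x"])
  show "vectorspace K A" using A by (simp add: P_algebra_def)
  fix x y assume xy: "x \<in> carrier A" "y \<in> carrier A"
  then have "(\<lambda>y. m x y) \<in> module_hom K A A"
    using A by (simp add: P_algebra_def bilinear_mult_def)
  from module_hom_apply_closed[OF this] show "m' x y \<in> carrier A"
    using eq xy by simp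
qed (auto simp: eq module_hom_def)

text \<open>The map \<open>(x, w)\<close> to \<open>(x, f w)\<close> embeds the semidirect product
  on \<open>A\<close> and \<open>W\<close> into the one on \<open>A\<close> and \<open>V\<close>, so
  \<open>P_algebra_pullback\<close> applies to it. The intertwining conditions \<open>l'\<close> and
  \<open>r'\<close> say precisely that this embedding is multiplicative.\<close>

lemma representation_pullback:
  assumes P: "operad_over K P" and rep: "representation K P A m l r V" and W: "vectorspace K W"
    and m': "\<And>x y. x \<in> carrier A \<Longrightarrow> y \<in> carrier A \<Longrightarrow> m' x y = m x y"
    and f: "f \<in> module_hom K W V" and inj: "inj_on f (carrier W)"
    and l'_closed: "\<And>x w. x \<in> carrier A \<Longrightarrow> w \<in> carrier W \<Longrightarrow> l' x w \<in> carrier W"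
    and r'_closed: "\<And>x w. x \<in> carrier A \<Longrightarrow> w \<in> carrier W \<Longrightarrow> r' x w \<in> carrier W"
    and l'_ext: "\<And>x. l' x \<in> extensional (carrier W)"
    and r'_ext: "\<And>x. r' x \<in> extensional (carrier W)"
    and l': "\<And>x w. x \<in> carrier A \<Longrightarrow> w \<in> carrier W \<Longrightarrow> f (l' x w) = l x (f w)"
    and r': "\<And>x w. x \<in> carrier A \<Longrightarrow> w \<in> carrier W \<Longrightarrow> f (r' x w) = r x (f w)"
  shows "representation K P A m' l' r' W"
proof -
  have alg: "P_algebra K P A m" and V: "vectorspace K V"
    and lr: "l \<in> module_hom K A (End_space K V)" "r \<in> module_hom K A (End_space K V)"
    and sd: "P_algebra K P (direct_sum A V) (\<lambda>(x, u) (y, v). (m x y, l x v \<oplus>\<^bsub>V\<^esub> r y u))"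
    using rep by (auto simp: representation_def)
  have alg': "P_algebra K P A m'"
    by (rule P_algebra_cong[OF P alg m'])
  have A: "vectorspace K A"
    using alg by (simp add: P_algebra_def)
  interpret A: vectorspace K A by fact
  interpret V: vectorspace K V by fact
  interpret W: vectorspace K W by fact
  interpret f: mod_hom K W V f by unfold_locales fact
  note f_eqD = inj_onD[OF inj]
  \<comment> \<open>One argument serves both \<open>l'\<close> and \<open>r'\<close>: linearity of
    \<open>k' x\<close> in the vector, and of \<open>k'\<close> in \<open>x\<close>, is checked
    after applying the injective \<open>f\<close>, where it becomes linearity of
    \<open>k\<close>.\<close>
  have hom: "k' \<in> module_hom K A (End_space K W)"
    if k: "k \<in> module_hom K A (End_space K V)"
      and closed: "\<And>x w. x \<in> carrier A \<Longrightarrow> w \<in> carrier W \<Longrightarrow> k' x w \<in> carrier W"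
      and ext: "\<And>x. k' x \<in> extensional (carrier W)"
      and k': "\<And>x w. x \<in> carrier A \<Longrightarrow> w \<in> carrier W \<Longrightarrow> f (k' x w) = k x (f w)" for k k'
  proof -
    note kx = hom_space_carrierD[OF module_hom_apply_closed[OF k]]
    have mem: "k' x \<in> carrier (End_space K W)" if "x \<in> carrier A" for x
    proof -
      have "k' x \<in> module_hom K W W"
        by (intro module_homI; (rule f_eqD)?)
          (use that in \<open>simp_all add: closed k' module_hom_add[OF kx] module_hom_smult[OF kx]\<close>)
      then show ?thesis
        using ext by (simp add: hom_space_def)
    qed
    interpret E: vectorspace K "End_space K W"
      by (rule vectorspace_hom_space[OF W W])
    show ?thesis
      by (intro module_homI; (rule hom_space_ext[of _ K W W])?; (rule f_eqD)?)
        (simp_all add: mem closed k' module_hom_add[OF k] module_hom_smult[OF k])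
  qed
  have "P_algebra K P (direct_sum A W) (\<lambda>(x, u) (y, v). (m' x y, l' x v \<oplus>\<^bsub>W\<^esub> r' y u))"
  proof (rule P_algebra_pullback[OF P sd, where f = "\<lambda>(x, w). (x, f w)"])
    show "vectorspace K (direct_sum A W)"
      by (rule direct_sum_is_vs[OF A W])
    show "(\<lambda>(x, w). (x, f w)) \<in> module_hom K (direct_sum A W) (direct_sum A V)"
      by (rule module_homI) (auto simp: direct_sum_def)
    show "inj_on (\<lambda>(x, w). (x, f w)) (carrier (direct_sum A W))"
      using inj by (auto simp: inj_on_def direct_sum_def)
  next
    fix p q assume "p \<in> carrier (direct_sum A W)" "q \<in> carrier (direct_sum A W)"
    moreover have "m' x y \<in> carrier A" if "x \<in> carrier A" "y \<in> carrier A" for x y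
      using alg' that module_hom_apply_closed[of "\<lambda>y. m' x y" K A A y]
      by (simp add: P_algebra_def bilinear_mult_def)
    ultimately
    show "(case p of (x, u) \<Rightarrow> \<lambda>(y, v). (m' x y, l' x v \<oplus>\<^bsub>W\<^esub> r' y u)) q \<in> carrier (direct_sum A W)"
      and "(case (case p of (x, u) \<Rightarrow> \<lambda>(y, v). (m' x y, l' x v \<oplus>\<^bsub>W\<^esub> r' y u)) q of
              (x, w) \<Rightarrow> (x, f w)) =
           (case case p of (x, w) \<Rightarrow> (x, f w) of
              (x, u) \<Rightarrow> \<lambda>(y, v). (m x y, l x v \<oplus>\<^bsub>V\<^esub> r y u)) (case q of (x, w) \<Rightarrow> (x, f w))"
      by (auto simp: direct_sum_def l'_closed r'_closed l' r' m')
  qed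
  then show ?thesis
    using alg' W hom[OF lr(1) l'_closed l'_ext l'] hom[OF lr(2) r'_closed r'_ext r']
    by (simp add: representation_def)
qed

section \<open>Dual operators\<close>

text \<open>Evaluating at a functional and then at a vector turns the matrix combination into an
  expression in \<open>K\<close>; operators on different dual spaces are compared in this
  form.\<close>

lemma pair_times_mat_dual_map:
  assumes "u \<in> carrier (dual_space K V)" and "v \<in> carrier V"
  shows "pair_times_mat K (dual_space K V) (dual_map K V \<alpha>) (dual_map K V \<beta>) M j x u v =
    M $$ (0, j) \<otimes>\<^bsub>K\<^esub> (\<ominus>\<^bsub>K\<^esub> u (\<alpha> x v)) \<oplus>\<^bsub>K\<^esub> M $$ (1, j) \<otimes>\<^bsub>K\<^esub> (\<ominus>\<^bsub>K\<^esub> u (\<beta> x v))"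
proof -
  have [simp]: "add (scalar_space K) = add K" "smult (scalar_space K) = mult K"
    by (simp_all add: scalar_space_def)
  show ?thesis
    using assms by (simp add: pair_times_mat_def dual_map_def)
qed

lemma dual_map_closed:
  assumes V: "vectorspace K V" and \<rho>: "\<rho> x \<in> module_hom K V V"
    and u: "u \<in> carrier (dual_space K V)"
  shows "dual_map K V \<rho> x u \<in> carrier (dual_space K V)"
proof -
  interpret V: vectorspace K V by fact
  have "(\<lambda>v. u (\<rho> x v)) \<in> module_hom K V (scalar_space K)"
    by (rule module_hom_comp[OF \<rho> hom_space_carrierD[OF u]])
  then have "(\<lambda>v. \<ominus>\<^bsub>K\<^esub> u (\<rho> x v)) \<in> module_hom K V (scalar_space K)"
    by (auto simp: module_hom_def scalar_space_def V.R.minus_add V.R.r_minus Pi_def)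
  from hom_space_carrierI[OF V this] show ?thesis
    using u by (simp add: dual_map_def)
qed

lemma pair_times_mat_dual_map_closed:
  assumes V: "vectorspace K V" and "\<alpha> x \<in> module_hom K V V" and "\<beta> x \<in> module_hom K V V"
    and "M $$ (0, j) \<in> carrier K" and "M $$ (1, j) \<in> carrier K"
    and "u \<in> carrier (dual_space K V)"
  shows "pair_times_mat K (dual_space K V) (dual_map K V \<alpha>) (dual_map K V \<beta>) M j x u
    \<in> carrier (dual_space K V)"
proof -
  interpret D: vectorspace K "dual_space K V"
    by (rule vectorspace_dual_space[OF V])
  show ?thesis
    using assms by (simp add: pair_times_mat_def dual_map_closed)
qed

text \<open>Addition in a hom space restricts its result to the carrier, so this holds for every
  \<open>x\<close>, even outside \<open>A\<close>, as \<open>representation_pullback\<close>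
  demands.\<close>

lemma pair_times_mat_extensional:
  "pair_times_mat K W f g M j x \<in> extensional (carrier W)"
  by (simp add: pair_times_mat_def hom_space_def)

text \<open>Dualizing reverses arrows: the surjection \<open>T\<close> from \<open>V\<close> to
  \<open>W\<close> has an injective transpose from the dual of \<open>W\<close> to the dual of
  \<open>V\<close>, and \<open>T\<close> intertwining \<alpha> with \<open>\<alpha>'\<close> and
  \<beta> with \<open>\<beta>'\<close> makes the transpose intertwine the dual operators. The
  representation is therefore pulled back from the dual of \<open>V\<close> to the dual of
  \<open>W\<close>. The product may change as long as it agrees on the carrier.\<close>

lemma dual_representation_transport:
  assumes P: "operad_over K P"
    and M: "M \<in> carrier_mat 2 2" "elements_mat M \<subseteq> carrier K"
    and rep: "dual_representation K P M A m \<alpha> \<beta> V"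
    and V: "vectorspace K V" and W: "vectorspace K W"
    and m': "\<And>x y. x \<in> carrier A \<Longrightarrow> y \<in> carrier A \<Longrightarrow> m' x y = m x y"
    and T: "T \<in> module_hom K V W" and surj: "T ` carrier V = carrier W"
    and \<alpha>_closed: "\<And>x. x \<in> carrier A \<Longrightarrow> \<alpha> x \<in> module_hom K V V"
    and \<beta>_closed: "\<And>x. x \<in> carrier A \<Longrightarrow> \<beta> x \<in> module_hom K V V"
    and \<alpha>'_closed: "\<And>x. x \<in> carrier A \<Longrightarrow> \<alpha>' x \<in> module_hom K W W"
    and \<beta>'_closed: "\<And>x. x \<in> carrier A \<Longrightarrow> \<beta>' x \<in> module_hom K W W"
    and \<alpha>': "\<And>x v. x \<in> carrier A \<Longrightarrow> v \<in> carrier V \<Longrightarrow> \<alpha>' x (T v) = T (\<alpha> x v)"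
    and \<beta>': "\<And>x v. x \<in> carrier A \<Longrightarrow> v \<in> carrier V \<Longrightarrow> \<beta>' x (T v) = T (\<beta> x v)"
  shows "dual_representation K P M A m' \<alpha>' \<beta>' W"
proof -
  \<comment> \<open>The transpose of \<open>T\<close>, restricted so that its values are extensional
    functionals.\<close>
  let ?f = "\<lambda>u. \<lambda>v\<in>carrier V. u (T v)"
  let ?V = "pair_times_mat K (dual_space K V) (dual_map K V \<alpha>) (dual_map K V \<beta>) M"
  let ?W = "pair_times_mat K (dual_space K W) (dual_map K W \<alpha>') (dual_map K W \<beta>') M"
  interpret V: vectorspace K V by fact
  interpret DV: vectorspace K "dual_space K V" by (rule vectorspace_dual_space[OF V])
  interpret DW: vectorspace K "dual_space K W" by (rule vectorspace_dual_space[OF W])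
  have M': "M $$ (i, j) \<in> carrier K" if "i < 2" "j < 2" for i j
    using M that by blast
  note T_closed = module_hom_apply_closed[OF T]
  have f_closed: "?f u \<in> carrier (dual_space K V)" if "u \<in> carrier (dual_space K W)" for u
    by (rule hom_space_carrierI[OF V module_hom_comp[OF T hom_space_carrierD[OF that]]])
  have f: "?f \<in> module_hom K (dual_space K W) (dual_space K V)"
    by (intro module_homI; (rule hom_space_ext[of _ K V "scalar_space K"])?)
      (simp_all add: f_closed T_closed del: restrict_apply, simp_all add: T_closed)
  have inj: "inj_on ?f (carrier (dual_space K W))"
  proof (rule inj_onI)
    fix u u' assume u: "u \<in> carrier (dual_space K W)" "u' \<in> carrier (dual_space K W)"
      and eq: "?f u = ?f u'"
    show "u = u'"
    proof (rule hom_space_ext[OF u])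
      fix w assume "w \<in> carrier W"
      \<comment> \<open>Surjectivity enters here: a functional on \<open>W\<close> is determined by
        its values on the image of \<open>T\<close>.\<close>
      then obtain v where "v \<in> carrier V" "w = T v" using surj by blast
      then show "u w = u' w" using fun_cong[OF eq, of v] by simp
    qed
  qed
  have V_closed: "?V j x u \<in> carrier (dual_space K V)"
    if "j < 2" "x \<in> carrier A" "u \<in> carrier (dual_space K V)" for j x u
    using that by (intro pair_times_mat_dual_map_closed V M' \<alpha>_closed \<beta>_closed) auto
  have W_closed: "?W j x u \<in> carrier (dual_space K W)"
    if "j < 2" "x \<in> carrier A" "u \<in> carrier (dual_space K W)" for j x u
    using that by (intro pair_times_mat_dual_map_closed W M' \<alpha>'_closed \<beta>'_closed) auto
  \<comment> \<open>At \<open>v\<close> the two sides involve \<open>u (\<alpha>' x (T v))\<close>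
    and \<open>u (T (\<alpha> x v))\<close>, and likewise for \<beta>, with the same matrix
    coefficients.\<close>
  have intertwine: "?f (?W j x u) = ?V j x (?f u)"
    if "j < 2" "x \<in> carrier A" "u \<in> carrier (dual_space K W)" for j x u
  proof (rule hom_space_ext)
    show "?f (?W j x u) \<in> carrier (dual_space K V)"
      by (rule f_closed[OF W_closed[OF that]])
    show "?V j x (?f u) \<in> carrier (dual_space K V)"
      by (rule V_closed[OF that(1,2) f_closed[OF that(3)]])
    fix v assume "v \<in> carrier V"
    with that show "?f (?W j x u) v = ?V j x (?f u) v"
      using module_hom_apply_closed[OF \<alpha>_closed] module_hom_apply_closed[OF \<beta>_closed]
      by (simp add: pair_times_mat_dual_map f_closed T_closed \<alpha>' \<beta>')
  qed
  show ?thesis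
    unfolding dual_representation_def
  proof (rule representation_pullback[OF P rep[unfolded dual_representation_def]
        DW.vectorspace_axioms m' f inj])
    fix x u assume xu: "x \<in> carrier A" "u \<in> carrier (dual_space K W)"
    show "?W 0 x u \<in> carrier (dual_space K W)" "?W 1 x u \<in> carrier (dual_space K W)"
      using xu by (auto intro: W_closed)
    show "?f (?W 0 x u) = ?V 0 x (?f u)" "?f (?W 1 x u) = ?V 1 x (?f u)"
      using xu by (rule intertwine[rotated 1]; simp)+
  qed (simp_all add: pair_times_mat_extensional)
qed

section \<open>Pre-algebras and operators\<close>

lemma bilinear_mult_left_mult:
  assumes A: "vectorspace K A" and m: "bilinear_mult K A m"
  shows "left_mult A m \<in> module_hom K A (End_space K A)"
proof -
  interpret A: vectorspace K A by fact
  interpret E: vectorspace K "End_space K A" by (rule vectorspace_hom_space[OF A A])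
  have l: "(\<lambda>y. m x y) \<in> module_hom K A A" and r: "(\<lambda>y. m y x) \<in> module_hom K A A"
    if "x \<in> carrier A" for x
    using m that by (auto simp: bilinear_mult_def)
  have closed: "left_mult A m x \<in> carrier (End_space K A)" if "x \<in> carrier A" for x
    unfolding left_mult_def by (rule hom_space_carrierI[OF A l[OF that]])
  show ?thesis
    by (intro module_homI; (rule hom_space_ext[of _ K A A])?)
      (simp_all add: closed, simp_all add: left_mult_def module_hom_add[OF r] module_hom_smult[OF r])
qed

text \<open>Right multiplication is left multiplication for the opposite product, and bilinearity is
  symmetric under that exchange.\<close>

lemma bilinear_mult_right_mult:
  assumes "vectorspace K A" and "bilinear_mult K A m"
  shows "right_mult A m \<in> module_hom K A (End_space K A)"
proof -
  have "right_mult A m = left_mult A (\<lambda>x y. m y x)"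
    by (simp add: left_mult_def right_mult_def fun_eq_iff)
  moreover have "bilinear_mult K A (\<lambda>x y. m y x)"
    using assms(2) by (simp add: bilinear_mult_def)
  ultimately show ?thesis
    using bilinear_mult_left_mult[OF assms(1)] by simp
qed

text \<open>For the identity operator, the defining equation of an operator is the decomposition of
  \<open>m\<close> into \<open>succ\<close> and \<open>prec\<close>.\<close>

lemma invertible_operator_of_pre_algebra:
  assumes P: "operad_over K P"
    and M: "M \<in> carrier_mat 2 2" "elements_mat M \<subseteq> carrier K"
    and pre: "compatible_dual_pre_P_algebra K P M A m succ prec"
  shows "invertible_dual_O_operator K P M A m (left_mult A succ) (right_mult A prec) A (\<lambda>x. x)"
proof -
  have A: "vectorspace K A" and bil: "bilinear_mult K A succ" "bilinear_mult K A prec"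
    and rep: "dual_representation K P M A (\<lambda>x y. succ x y \<oplus>\<^bsub>A\<^esub> prec x y)
       (left_mult A succ) (right_mult A prec) A"
    and eq: "\<And>x y. x \<in> carrier A \<Longrightarrow> y \<in> carrier A \<Longrightarrow> m x y = succ x y \<oplus>\<^bsub>A\<^esub> prec x y"
    using pre by (auto simp: compatible_dual_pre_P_algebra_def dual_pre_P_algebra_def)
  interpret A: vectorspace K A by fact
  note hom = bilinear_mult_left_mult[OF A bil(1)] bilinear_mult_right_mult[OF A bil(2)]
  note closed = hom[THEN module_hom_apply_closed, THEN hom_space_carrierD]
  have id: "(\<lambda>x. x) \<in> module_hom K A A"
    by (rule module_homI) simp_all
  \<comment> \<open>The representation is given for the sum of \<open>succ\<close> and
    \<open>prec\<close>, which equals \<open>m\<close> on the carrier only; transport along the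
    identity replaces the product.\<close>
  have "dual_representation K P M A m (left_mult A succ) (right_mult A prec) A"
    by (rule dual_representation_transport[OF P M rep A A eq id _ closed closed]) simp_all
  moreover have "linear_map K A A (\<lambda>x. x)"
    by unfold_locales (rule id)
  ultimately show ?thesis
    using hom eq
    by (simp add: invertible_dual_O_operator_def dual_O_operator_def left_mult_def right_mult_def
        bij_betw_def)
qed

text \<open>The new left and right multiplications are the conjugates of \<alpha> and \<beta> by
  \<open>T\<close>, so \<open>T\<close> intertwines them and the dual representation can be
  transported from \<open>V\<close> to \<open>A\<close>.\<close>

lemma pre_algebra_of_invertible_operator:
  assumes P: "operad_over K P"
    and M: "M \<in> carrier_mat 2 2" "elements_mat M \<subseteq> carrier K"
    and alg: "P_algebra K P A m"
    and op: "invertible_dual_O_operator K P M A m \<alpha> \<beta> V T"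
  shows "compatible_dual_pre_P_algebra K P M A m
    (\<lambda>x y. T (\<alpha> x (inv_into (carrier V) T y))) (\<lambda>x y. T (\<beta> y (inv_into (carrier V) T x)))"
proof -
  define S where "S = inv_into (carrier V) T"
  have hom: "\<alpha> \<in> module_hom K A (End_space K V)" "\<beta> \<in> module_hom K A (End_space K V)"
    and rep: "dual_representation K P M A m \<alpha> \<beta> V"
    and lin: "linear_map K V A T" and bij: "bij_betw T (carrier V) (carrier A)"
    and eq: "\<And>u v. u \<in> carrier V \<Longrightarrow> v \<in> carrier V \<Longrightarrow>
      m (T u) (T v) = T (\<alpha> (T u) v \<oplus>\<^bsub>V\<^esub> \<beta> (T v) u)"
    using op by (auto simp: invertible_dual_O_operator_def dual_O_operator_def)
  interpret T: linear_map K V A T by fact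
  have V: "vectorspace K V" and A: "vectorspace K A" by unfold_locales
  have T: "T \<in> module_hom K V A" by (rule T.T_hom)
  have S: "S \<in> module_hom K A V"
    unfolding S_def by (rule module_hom_inv_into[OF V T bij])
  have TS: "T (S x) = x" if "x \<in> carrier A" for x
    using bij that by (simp add: S_def bij_betw_def f_inv_into_f)
  have ST: "S (T v) = v" if "v \<in> carrier V" for v
    using bij that by (simp add: S_def bij_betw_def)
  note S_closed = module_hom_apply_closed[OF S]
  note closed = hom[THEN module_hom_apply_closed, THEN hom_space_carrierD]
  note closed' = closed[THEN module_hom_apply_closed]
  \<comment> \<open>Linearity in the algebra element with the vector fixed; this covers the argument
    of each product that selects the operator.\<close>
  have fst_lin: "(\<lambda>x. \<gamma> x v) \<in> module_hom K A V"
    if "\<gamma> \<in> module_hom K A (End_space K V)" "v \<in> carrier V" for \<gamma> v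
    using that(2) module_hom_add[OF that(1)] module_hom_smult[OF that(1)]
      module_hom_apply_closed[OF hom_space_carrierD[OF module_hom_apply_closed[OF that(1)]]]
    by (intro module_homI) simp_all
  let ?succ = "\<lambda>x y. T (\<alpha> x (S y))" and ?prec = "\<lambda>x y. T (\<beta> y (S x))"
  have bil: "bilinear_mult K A ?succ" "bilinear_mult K A ?prec"
    unfolding bilinear_mult_def
    by (auto intro!: module_hom_comp[OF _ T] module_hom_comp[OF S] closed fst_lin hom S_closed)
  \<comment> \<open>This is the operator identity at the preimages of \<open>x\<close> and
    \<open>y\<close>, with \<open>T\<close> distributed over the sum.\<close>
  have sum: "?succ x y \<oplus>\<^bsub>A\<^esub> ?prec x y = m x y" if "x \<in> carrier A" "y \<in> carrier A" for x y
    using eq[OF S_closed S_closed, OF that] that by (simp add: TS S_closed closed')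
  have "P_algebra K P A (\<lambda>x y. ?succ x y \<oplus>\<^bsub>A\<^esub> ?prec x y)"
    by (rule P_algebra_cong[OF P alg sum])
  moreover have "dual_representation K P M A (\<lambda>x y. ?succ x y \<oplus>\<^bsub>A\<^esub> ?prec x y)
      (left_mult A ?succ) (right_mult A ?prec) A"
  proof (rule dual_representation_transport[OF P M rep V A sum T _ closed])
    show "T ` carrier V = carrier A"
      using bij by (simp add: bij_betw_def)
    show "left_mult A ?succ x \<in> module_hom K A A" if "x \<in> carrier A" for x
      using bilinear_mult_left_mult[OF A bil(1)] that
      by (blast intro: hom_space_carrierD module_hom_apply_closed)
    show "right_mult A ?prec x \<in> module_hom K A A" if "x \<in> carrier A" for x
      using bilinear_mult_right_mult[OF A bil(2)] that
      by (blast intro: hom_space_carrierD module_hom_apply_closed)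
  \<comment> \<open>The remaining intertwining conditions reduce to
    \<open>S (T v) = v\<close>.\<close>
  qed (simp_all add: left_mult_def right_mult_def ST)
  ultimately show ?thesis
    using A bil sum
    by (simp add: compatible_dual_pre_P_algebra_def dual_pre_P_algebra_def flip: S_def)
qed

text \<open>The existential lets \<open>V\<close> range over spaces with elements in the type of
  \<open>A\<close>, where the witness \<open>V = A\<close> lives. The formulas for the two products
  are asserted for \<open>V\<close> over an arbitrary element type \<open>'v\<close>.\<close>

theorem theorem2p15:
  fixes K :: "'k ring"
    and P :: "'k binary_quadratic_operad"
    and M :: "'k mat"
    and A :: "('k, 'a) module"
    and m :: "'a \<Rightarrow> 'a \<Rightarrow> 'a"
  assumes "algebraically_closed K" and "char_zero K"
    and "operad_over K P"
    and "M \<in> carrier_mat 2 2" and "elements_mat M \<subseteq> carrier K"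
    and "fd_vectorspace K A" and "P_algebra K P A m"
  shows "((\<exists>succ prec. compatible_dual_pre_P_algebra K P M A m succ prec) \<longleftrightarrow>
          (\<exists>(V :: ('k, 'a) module) \<alpha> \<beta> T.
             fd_vectorspace K V \<and> invertible_dual_O_operator K P M A m \<alpha> \<beta> V T))
       \<and> (\<forall>(V :: ('k, 'v) module) \<alpha> \<beta> T.
             fd_vectorspace K V \<and> invertible_dual_O_operator K P M A m \<alpha> \<beta> V T \<longrightarrow>
             compatible_dual_pre_P_algebra K P M A m
               (\<lambda>x y. T (\<alpha> x (inv_into (carrier V) T y)))
               (\<lambda>x y. T (\<beta> y (inv_into (carrier V) T x))))"
proof (intro conjI iffI allI impI; elim exE conjE)
  fix succ prec
  assume "compatible_dual_pre_P_algebra K P M A m succ prec"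
  \<comment> \<open>The witness is \<open>A\<close> itself with the identity map, so its finite
    dimension is that of \<open>A\<close>.\<close>
  with assms(6) show "\<exists>(V :: ('k, 'a) module) \<alpha> \<beta> T.
      fd_vectorspace K V \<and> invertible_dual_O_operator K P M A m \<alpha> \<beta> V T"
    by (blast intro: invertible_operator_of_pre_algebra[OF assms(3-5)])
next
  fix V :: "('k, 'a) module" and \<alpha> \<beta> T
  assume "invertible_dual_O_operator K P M A m \<alpha> \<beta> V T"
  from pre_algebra_of_invertible_operator[OF assms(3-5,7) this]
  show "\<exists>succ prec. compatible_dual_pre_P_algebra K P M A m succ prec"
    by (intro exI)
\<comment> \<open>The lemma is polymorphic in the element type of \<open>V\<close>, so it serves
  here at \<open>'v\<close> as it did above at \<open>'a\<close>.\<close>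
qed (rule pre_algebra_of_invertible_operator[OF assms(3-5,7)])

end
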